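(* Let $n,m\ge 1$ be integers, $\Delta>0$, $\sigma>0$, and let $\mathbf{x},\widehat{\mathbf{x}}\in\mathbb{R}^n$ be fixed (non-random) vectors, with $\epsilon=\|\mathbf{x}-\widehat{\mathbf{x}}\|_2$. Let $\mathbf{A}\in\mathbb{R}^{m\times n}$ have i.i.d. $\mathcal{N}(0,\sigma^2)$ entries, and let $\mathbf{w}\in\mathbb{R}^m$ have i.i.d. entries uniform on $[-1,0)$, independent of $\mathbf{A}$. Set $\mathbf{y}=\frac1\Delta\mathbf{A}\mathbf{x}+\mathbf{w}$, $\widehat{\mathbf{y}}=\frac1\Delta\mathbf{A}\widehat{\mathbf{x}}+\mathbf{w}$, and $\mathbf{q}\in\mathbb{Z}^m$ with $\mathbf{q}_i=Q(\mathbf{y}_i)=\lfloor \mathbf{y}_i+\tfrac12\rfloor$. Let $k\ge 1$ and suppose the first $k-1$ least significant bitplanes $\mathbf{q}_{(1)},\ldots,\mathbf{q}_{(k-1)}$ of $\mathbf{q}$ are perfectly known. Then the $k$-th bitplane $\mathbf{q}_{(k)}$ can be estimated from $\widehat{\mathbf{x}}$ (through $\widehat{\mathbf{y}}$) and $\mathbf{q}_{(1)},\ldots,\mathbf{q}_{(k-1)}$, by the nearest-consistent-interval predictor $\widehat{\mathbf{q}}_{(k)}$ defined in the context, with bit error probability (for each coordinate of the bitplane, the probability being over $\mathbf{A}$ and $\mathbf{w}$) equal to $$p_k=\Pr\big(\widehat{q}_{(k)}\neq q_{(k)}\big)=\frac12-\sum_{l=1}^{+\infty}e^{-\frac12\left(\frac{\pi\sigma\epsilon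 l}{2^{k-1}\Delta}\right)^2}\,\mathrm{sinc}\!\left(\frac{l}{2^k}\right)\mathrm{sinc}\!\left(\frac l2\right).$$
   Context: $\mathrm{sinc}(u)=\frac{\sin(\pi u)}{\pi u}$ is the normalized sinc function (with $\mathrm{sinc}(0)=1$). Bits and bitplanes: for an integer $q$, its $k$-th bit is $q_{(k)}=\lfloor q/2^{k-1}\rfloor \bmod 2\in\{0,1\}$, so $k=1$ is the least significant bit (negative integers are handled as in two's complement; the quantizer is assumed to have enough bits that it does not saturate). The $k$-th bitplane $\mathbf{q}_{(k)}\in\{0,1\}^m$ of $\mathbf{q}\in\mathbb{Z}^m$ is the vector of the $k$-th bits of its entries. Nearest-consistent-interval predictor (applied coordinate by coordinate): let $y,\widehat y$ be corresponding entries of $\mathbf{y},\widehat{\mathbf{y}}$ and $q=Q(y)$. The quantization interval of an integer $j$ is $[j-\frac12,j+\frac12)$, with midpoint $j$. Given the known bits $q_{(1)},\ldots,q_{(k-1)}$, an integer $j$ is called consistent if $j_{(i)}=q_{(i)}$ for all $i=1,\ldots,k-1$ (every integer is consistent if $k=1$). Let $j^\star$ be a consistent integer minimizing $|\widehat y-j|$ (ties broken arbitrarily). The predictor is $\widehat q_{(k)}=j^\star_{(k)}$, the $k$-th bit of $j^\star$. *)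

theory Defs
  imports "HOL-Probability.Probability"
begin

definition nsinc :: "real \<Rightarrow> real" where
  "nsinc u = (if u = 0 then 1 else sin (pi * u) / (pi * u))"

definition quantize :: "real \<Rightarrow> int" where
  "quantize y = \<lfloor>y + 1/2\<rfloor>"

text \<open>Bits are numbered from 1, the least significant one. On \<^typ>\<open>int\<close>, \<^term>\<open>(div)\<close> rounds
  towards minus infinity, so negative integers are read in two's complement.\<close>

definition qbit :: "nat \<Rightarrow> int \<Rightarrow> int" where
  "qbit k q = (q div 2 ^ (k - 1)) mod 2"

definition bitplane :: "nat \<Rightarrow> int ^ 'm \<Rightarrow> int ^ 'm" where
  "bitplane k q = (\<chi> i. qbit k (q $ i))"

text \<open>In a list \<open>bs\<close> of known bits, \<open>bs ! i\<close> is the bit number \<open>Suc i\<close>.\<close>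

definition consistent :: "int list \<Rightarrow> int \<Rightarrow> bool" where
  "consistent bs j \<longleftrightarrow> (\<forall>i < length bs. qbit (Suc i) j = bs ! i)"

definition nearest_consistent :: "real \<Rightarrow> int list \<Rightarrow> int \<Rightarrow> bool" where
  "nearest_consistent yhat bs j \<longleftrightarrow>
     is_arg_min (\<lambda>j. \<bar>yhat - real_of_int j\<bar>) (consistent bs) j"

text \<open>A selection rule picks a nearest consistent integer from the predicted measurement and the
  known bits. Ties are broken in any way: the rule is an arbitrary function with this property.
  It is constrained only on lists of \<open>k - 1\<close> binary digits, since no integer is consistent with
  a list that contains another number.\<close>

definition nearest_consistent_rule :: "nat \<Rightarrow> (real \<Rightarrow> int list \<Rightarrow> int) \<Rightarrow> bool" where
  "nearest_consistent_rule k rule \<longleftrightarrow>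
     (\<forall>yhat bs. length bs = k - 1 \<and> set bs \<subseteq> {0, 1} \<longrightarrow> nearest_consistent yhat bs (rule yhat bs))"

text \<open>The prediction of bitplane \<open>k\<close> sees only \<open>yhat\<close> and the list of the known bitplanes
  \<open>1, \<dots>, k - 1\<close>.\<close>

definition predicted_bitplane ::
  "(real \<Rightarrow> int list \<Rightarrow> int) \<Rightarrow> nat \<Rightarrow> real ^ 'm \<Rightarrow> (int ^ 'm) list \<Rightarrow> int ^ 'm" where
  "predicted_bitplane rule k yhat planes =
     (\<chi> i. qbit k (rule (yhat $ i) (map (\<lambda>p. p $ i) planes)))"

lemma consistent_exists:
  assumes "set bs \<subseteq> {0, 1}"
  shows "\<exists>j. consistent bs j"
proof
  let ?j = "horner_sum of_bool 2 (map (\<lambda>b. b = 1) bs) :: int"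
  show "consistent bs ?j"
    unfolding consistent_def
  proof (intro allI impI)
    fix i assume i: "i < length bs"
    then have "bs ! i \<in> {0, 1}" using assms nth_mem by blast
    moreover have "qbit (Suc i) ?j = of_bool (bit ?j i)"
      by (simp add: qbit_def bit_iff_odd mod_2_eq_odd)
    ultimately show "qbit (Suc i) ?j = bs ! i"
      using i by (auto simp: bit_horner_sum_bit_iff)
  qed
qed

lemma nearest_consistent_exists:
  assumes "set bs \<subseteq> {0, 1}"
  shows "\<exists>j. nearest_consistent yhat bs j"
proof -
  obtain j0 where j0: "consistent bs j0" using consistent_exists[OF assms] by blast
  let ?d = "\<lambda>j. \<bar>yhat - real_of_int j\<bar>"
  let ?S = "{j. consistent bs j \<and> ?d j \<le> ?d j0}"
  have "?S \<subseteq> {\<lfloor>yhat - ?d j0\<rfloor>..\<lceil>yhat + ?d j0\<rceil>}"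
    by (auto simp: floor_le_iff le_ceiling_iff)
  then have "finite ?S" using finite_subset by blast
  moreover have "?S \<noteq> {}" using j0 by auto
  ultimately obtain j where "is_arg_min ?d (\<lambda>j. j \<in> ?S) j"
    using ex_is_arg_min_if_finite by blast
  then have "nearest_consistent yhat bs j"
    unfolding nearest_consistent_def is_arg_min_def mem_Collect_eq
    by (meson less_le_trans less_imp_le)
  then show ?thesis by blast
qed

lemma nearest_consistent_rule_exists: "\<exists>rule. nearest_consistent_rule k rule"
proof
  show "nearest_consistent_rule k (\<lambda>yhat bs. SOME j. nearest_consistent yhat bs j)"
    unfolding nearest_consistent_rule_def
    using someI_ex[OF nearest_consistent_exists] by blast
qed

end

theory Submission
  imports Defs
begin

text \<open>Write \<open>y = q + r\<close> and \<open>yhat = q + r + z\<close>. Conditionally on \<open>A\<close> the rounding error \<open>r\<close> is uniform on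
  \<open>[-1/2, 1/2)\<close> because of the dither \<open>w\<close>, while \<open>z\<close> is a centred Gaussian with standard deviation
  \<open>\<sigma> \<epsilon> / \<Delta>\<close>. The integers consistent with the known bits form \<open>q + 2^(k-1) \<int>\<close>, so the predictor errs
  iff the integer nearest to \<open>(r + z) / 2^(k-1)\<close> is odd, that is, up to a null set of ties, iff
  \<open>cos V < 0\<close> for \<open>V = \<pi> (r + z) / 2^(k-1)\<close>.
  The error probability is thus \<open>E (1/2 - sgn (cos V) / 2)\<close>. The Fourier series of this square wave is
  handled by Abel summation: its Abel means are \<open>2/\<pi> Re (Arctan (\<rho> e^(i V)))\<close>, which are bounded and
  converge as \<open>\<rho>\<close> tends to 1. The coefficients \<open>E cos (l V)\<close> factor into the characteristic functions of
  \<open>r\<close> (a sinc) and of \<open>z\<close> (a Gaussian), and make the limit series absolutely convergent.\<close>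

subsection \<open>Abel summation of the square wave\<close>

text \<open>Since \<open>nsinc (l / 2)\<close> vanishes for even \<open>l \<ge> 2\<close>, these
  values identify it with the \<open>l\<close>-th Fourier cosine coefficient of the square wave
  \<open>sgn (cos \<theta>) / 2\<close>.\<close>

lemma nsinc_half_odd: "nsinc (real (2 * j + 1) / 2) = 2 / pi * ((-1) ^ j / real (2 * j + 1))"
proof -
  have "sin (pi * (real (2 * j + 1) / 2)) = cos (pi * real j)"
    by (simp add: sin_cos_eq field_simps)
  also have "\<dots> = (-1) ^ j"
    by (simp add: mult.commute)
  finally show ?thesis
    by (simp add: nsinc_def field_simps)
qed

lemma nsinc_half_even: "j \<noteq> 0 \<Longrightarrow> nsinc (real (2 * j) / 2) = 0"
  by (simp add: nsinc_def mult.commute)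

lemma abs_nsinc_le: "u > 0 \<Longrightarrow> \<bar>nsinc u\<bar> \<le> 1 / (pi * u)"
  by (auto simp: nsinc_def abs_mult intro!: divide_right_mono)

text \<open>Inside the unit disc the power series of \<open>Arctan\<close> converges, and by de
  Moivre its real part is a damped cosine series over the odd frequencies.\<close>

lemma abel_square_wave_sums:
  assumes "0 \<le> \<rho>" "\<rho> < 1"
  shows "(\<lambda>l. \<rho> ^ Suc l * (nsinc (real (Suc l) / 2) * cos (real (Suc l) * \<theta>)))
    sums (2 / pi * Re (Arctan (of_real \<rho> * cis \<theta>)))"
proof -
  let ?z = "of_real \<rho> * cis \<theta>" and ?f = "\<lambda>l. \<rho> ^ Suc l * (nsinc (real (Suc l) / 2) * cos (real (Suc l) * \<theta>))"
  have "norm ?z < 1" using assms by (simp add: norm_mult)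
  then have "(\<lambda>j. 2 / pi * Re ((-1)^j / of_nat (2*j+1) * ?z^(2*j+1))) sums (2 / pi * Re (Arctan ?z))"
    by (intro sums_mult sums_Re Arctan_series(2))
  also have "(\<lambda>j. 2 / pi * Re ((-1)^j / of_nat (2*j+1) * ?z^(2*j+1))) = (\<lambda>j. ?f (2 * j))"
  proof
    fix j
    have "(-1)^j / of_nat (2*j+1) * ?z^(2*j+1)
        = of_real ((-1)^j / real (2*j+1) * \<rho>^(2*j+1)) * cis (real (2*j+1) * \<theta>)"
      unfolding power_mult_distrib Complex.DeMoivre
      by (simp only: of_real_mult of_real_divide of_real_power of_real_minus of_real_1
          of_real_of_nat_eq mult.assoc)
    then have "Re ((-1)^j / of_nat (2*j+1) * ?z^(2*j+1))
        = (-1)^j / real (2*j+1) * \<rho>^(2*j+1) * cos (real (2*j+1) * \<theta>)"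
      by (simp only: Re_complex_of_real cis.sel times_complex.sel Im_complex_of_real)
    then show "2 / pi * Re ((-1)^j / of_nat (2*j+1) * ?z^(2*j+1)) = ?f (2 * j)"
      using nsinc_half_odd[of j] by simp
  qed
  \<comment> \<open>Index \<open>l\<close> carries frequency \<open>Suc l\<close>, so the even
    indices are the odd frequencies; the terms filled in at odd indices are zero.\<close>
  also have "(\<lambda>j. ?f (2 * j)) sums (2 / pi * Re (Arctan ?z)) \<longleftrightarrow> ?f sums (2 / pi * Re (Arctan ?z))"
  proof (rule sums_mono_reindex)
    show "strict_mono ((*) (2::nat))" by (simp add: strict_mono_def)
    fix l :: nat assume "l \<notin> range ((*) 2)"
    then have "odd l" by (auto elim: evenE)
    then obtain j where "l = 2 * j + 1" by (rule oddE)
    then have "Suc l = 2 * Suc j" by simp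
    then have "nsinc (real (Suc l) / 2) = 0" by (simp only: nsinc_half_even)
    then show "?f l = 0" by (simp only: mult_zero_left mult_zero_right)
  qed
  finally show ?thesis .
qed

text \<open>On the unit circle the quotient inside the logarithm that defines \<open>Arctan\<close>
  is purely imaginary, and the sign of \<open>cos \<theta>\<close> decides on which half of the
  imaginary axis it lies. The real part of \<open>Arctan\<close> is minus half its argument.\<close>

lemma Re_Arctan_cis:
  assumes "cos \<theta> \<noteq> 0"
  shows "Re (Arctan (cis \<theta>)) = pi / 4 * sgn (cos \<theta>)"
proof -
  have "sin \<theta> \<noteq> 1" "sin \<theta> \<noteq> - 1"
    using assms cos_squared_eq[of \<theta>] by auto
  then have s: "1 - sin \<theta> > 0" "1 + sin \<theta> > 0"
    using sin_le_one[of \<theta>] sin_ge_minus_one[of \<theta>] by linarith+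
  have c: "(cos \<theta>)\<^sup>2 = (1 - sin \<theta>) * (1 + sin \<theta>)"
    using sin_cos_squared_add[of \<theta>] by (simp add: algebra_simps power2_eq_square)
  have "1 - \<i> * cis \<theta> = - \<i> * of_real (cos \<theta> / (1 - sin \<theta>)) * (1 + \<i> * cis \<theta>)"
    using s c by (auto simp: complex_eq_iff field_simps power2_eq_square)
  moreover have "1 + \<i> * cis \<theta> \<noteq> 0" using s by (auto simp: complex_eq_iff)
  ultimately have q: "(1 - \<i> * cis \<theta>) / (1 + \<i> * cis \<theta>) = of_real (cos \<theta> / (1 - sin \<theta>)) * - \<i>"
    by (simp add: field_simps)
  have "Arg (of_real (cos \<theta> / (1 - sin \<theta>)) * - \<i>) = - pi / 2 * sgn (cos \<theta>)"
  proof (cases "cos \<theta> > 0")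
    case True
    then show ?thesis using s by (simp only: Arg_times_of_real divide_pos_pos) simp
  next
    case False
    then have "cos \<theta> < 0" using assms by simp
    then have "of_real (cos \<theta> / (1 - sin \<theta>)) * - \<i> = of_real (- cos \<theta> / (1 - sin \<theta>)) * \<i>"
      "- cos \<theta> / (1 - sin \<theta>) > 0"
      using s by (simp_all add: divide_neg_pos)
    then show ?thesis using \<open>cos \<theta> < 0\<close> by (simp only: Arg_times_of_real) simp
  qed
  then have "Im (Ln (of_real (cos \<theta> / (1 - sin \<theta>)) * - \<i>)) = - pi / 2 * sgn (cos \<theta>)"
    using s assms by (subst Arg_eq_Im_Ln[symmetric]) auto
  then show ?thesis unfolding Arctan_def q by simp
qed

definition abel :: "nat \<Rightarrow> real" where "abel n = 1 - 1 / real (Suc n)"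

lemma abel_bounds: "0 \<le> abel n" "abel n < 1"
  by (auto simp: abel_def field_simps)

lemma abel_tendsto: "abel \<longlonglongrightarrow> 1"
  unfolding abel_def using tendsto_diff[OF tendsto_const LIMSEQ_inverse_real_of_nat, of 1]
  by (simp add: inverse_eq_divide)

text \<open>The branch cuts of \<open>Arctan\<close> meet the unit circle only at i and -i, where
  the cosine vanishes; elsewhere continuity gives the radial limit.\<close>

lemma Re_Arctan_abel_tendsto:
  assumes "cos \<theta> \<noteq> 0"
  shows "(\<lambda>n. 2 / pi * Re (Arctan (of_real (abel n) * cis \<theta>))) \<longlonglongrightarrow> sgn (cos \<theta>) / 2"
proof -
  have "(\<lambda>n. of_real (abel n) * cis \<theta>) \<longlonglongrightarrow> cis \<theta>"
    using tendsto_mult[OF tendsto_of_real[OF abel_tendsto] tendsto_const] by simp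
  moreover have "isCont Arctan (cis \<theta>)" using assms by (intro continuous_at_Arctan) simp
  ultimately have "(\<lambda>n. Arctan (of_real (abel n) * cis \<theta>)) \<longlonglongrightarrow> Arctan (cis \<theta>)"
    by (rule isCont_tendsto_compose[rotated])
  then have "(\<lambda>n. 2 / pi * Re (Arctan (of_real (abel n) * cis \<theta>))) \<longlonglongrightarrow> 2 / pi * Re (Arctan (cis \<theta>))"
    by (intro tendsto_intros)
  then show ?thesis using Re_Arctan_cis[OF assms] by simp
qed

text \<open>The expected Abel means \<open>expectation (?g n)\<close> have two limits: bounded
  convergence yields the expected square wave, Tannery's theorem the series of expectations. The
  detour is needed because the Fourier series of a square wave does not converge absolutely, whereas
  the series of expectations does by \<open>sm\<close>.\<close>

lemma (in prob_space) prob_cos_neg: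
  fixes V :: "'a \<Rightarrow> real"
  assumes V [measurable]: "V \<in> borel_measurable M"
    and nz: "AE \<omega> in M. cos (V \<omega>) \<noteq> 0"
    and sm: "summable (\<lambda>l. \<bar>nsinc (real (Suc l) / 2) * expectation (\<lambda>\<omega>. cos (real (Suc l) * V \<omega>))\<bar>)"
  shows "prob {\<omega> \<in> space M. cos (V \<omega>) < 0} =
    1 / 2 - (\<Sum>l. nsinc (real (Suc l) / 2) * expectation (\<lambda>\<omega>. cos (real (Suc l) * V \<omega>)))"
proof -
  let ?a = "\<lambda>l. nsinc (real (Suc l) / 2) * expectation (\<lambda>\<omega>. cos (real (Suc l) * V \<omega>))"
  let ?f = "\<lambda>n l \<omega>. abel n ^ Suc l * (nsinc (real (Suc l) / 2) * cos (real (Suc l) * V \<omega>))"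
  let ?g = "\<lambda>n \<omega>. \<Sum>l. ?f n l \<omega>"
  have nsinc_le: "\<bar>nsinc (real (Suc l) / 2)\<bar> \<le> 1" for l
  proof -
    have "\<bar>nsinc (real (Suc l) / 2)\<bar> \<le> 1 / (pi * (real (Suc l) / 2))"
      by (intro abs_nsinc_le) auto
    also have "\<dots> \<le> 1"
      using pi_ge_two mult_mono[of 2 pi 1 "real (Suc l)"] by (simp add: field_simps)
    finally show ?thesis by simp
  qed
  have f_le: "\<bar>?f n l \<omega>\<bar> \<le> abel n ^ Suc l" for n l \<omega>
  proof -
    have "\<bar>nsinc (real (Suc l) / 2) * cos (real (Suc l) * V \<omega>)\<bar> \<le> 1 * 1"
      unfolding abs_mult by (intro mult_mono nsinc_le) auto
    then show ?thesis
      using abel_bounds[of n] mult_left_mono[of _ 1 "abel n ^ Suc l"] by (simp add: abs_mult)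
  qed
  have sf: "summable (\<lambda>l. abel n ^ Suc l)" for n
    using abel_bounds[of n] by (subst summable_Suc_iff) (simp add: summable_geometric)
  have int: "integrable M (\<lambda>\<omega>. cos (real (Suc l) * V \<omega>))" for l
    by (intro integrable_const_bound[of _ 1]) auto
  have g: "?g n \<omega> = 2 / pi * Re (Arctan (of_real (abel n) * cis (V \<omega>)))" for n \<omega>
    using abel_square_wave_sums[OF abel_bounds] by (simp add: sums_iff)
  \<comment> \<open>The damping factor \<open>abel n ^ Suc l\<close> is a summable majorant, which
    permits exchanging sum and expectation.\<close>
  have sums: "(\<lambda>l. expectation (?f n l)) sums expectation (?g n)" for n
  proof (rule sums_integral)
    show "integrable M (?f n l)" for l by (intro integrable_mult_right int)
    show "AE \<omega> in M. summable (\<lambda>l. norm (?f n l \<omega>))"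
      using f_le sf by (intro AE_I2 summable_comparison_test'[OF sf[of n]]) auto
    have "expectation (\<lambda>\<omega>. norm (?f n l \<omega>)) \<le> abel n ^ Suc l" for l
      using f_le[of n l]
      by (intro integral_le_const integrable_norm integrable_mult_right int) auto
    then show "summable (\<lambda>l. expectation (\<lambda>\<omega>. norm (?f n l \<omega>)))"
      by (intro summable_comparison_test'[OF sf[of n]]) auto
  qed
  have "(\<lambda>n. expectation (?g n)) \<longlonglongrightarrow> expectation (\<lambda>\<omega>. sgn (cos (V \<omega>)) / 2)"
  proof (rule integral_dominated_convergence[where w="\<lambda>_. 1"])
    show "AE \<omega> in M. (\<lambda>n. ?g n \<omega>) \<longlonglongrightarrow> sgn (cos (V \<omega>)) / 2"
      using nz by eventually_elim (simp only: g, rule Re_Arctan_abel_tendsto)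
    \<comment> \<open>The real part of \<open>Arctan\<close> stays below \<open>pi / 2\<close> in
      absolute value on the open disc, whence a bound uniform in \<open>n\<close>.\<close>
    show "AE \<omega> in M. norm (?g n \<omega>) \<le> 1" for n
    proof (rule AE_I2)
      fix \<omega>
      let ?z = "of_real (abel n) * cis (V \<omega>)"
      have "\<bar>Im ?z\<bar> \<le> norm ?z" by (rule abs_Im_le_cmod)
      also have "norm ?z < 1" using abel_bounds[of n] by (simp add: norm_mult)
      finally have "\<bar>Re (Arctan ?z)\<bar> < pi / 2" by (intro Re_Arctan_bounds)
      then show "norm (?g n \<omega>) \<le> 1"
        unfolding g by (simp add: abs_mult field_simps)
    qed
  qed (auto intro!: borel_measurable_suminf)
  moreover have "expectation (?g n) = (\<Sum>l. abel n ^ Suc l * ?a l)" for n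
    using sums_unique[OF sums[of n]] by (simp add: mult.assoc)
  moreover have "(\<lambda>n. \<Sum>l. abel n ^ Suc l * ?a l) \<longlonglongrightarrow> (\<Sum>l. ?a l)"
  proof (rule conjunct2[OF conjunct2[OF tannerys_theorem]])
    show "((\<lambda>n. abel n ^ Suc l * ?a l) \<longlongrightarrow> ?a l) sequentially" for l
      using tendsto_mult[OF tendsto_power[OF abel_tendsto] tendsto_const, of "Suc l" "?a l"] by simp
    show "\<forall>\<^sub>F (l, n) in at_top \<times>\<^sub>F sequentially. norm (abel n ^ Suc l * ?a l) \<le> \<bar>?a l\<bar>"
    proof (intro always_eventually allI, clarify)
      fix l n
      have "abel n ^ Suc l \<le> 1" using abel_bounds[of n] by (intro power_le_one) auto
      then have "abel n ^ Suc l * \<bar>?a l\<bar> \<le> 1 * \<bar>?a l\<bar>" by (intro mult_right_mono) auto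
      then show "norm (abel n ^ Suc l * ?a l) \<le> \<bar>?a l\<bar>"
        using abel_bounds[of n] by (simp add: abs_mult)
    qed
  qed (use sm in auto)
  ultimately have eq: "expectation (\<lambda>\<omega>. sgn (cos (V \<omega>)) / 2) = (\<Sum>l. ?a l)"
    by (simp only: LIMSEQ_unique)
  have "prob {\<omega> \<in> space M. cos (V \<omega>) < 0} = expectation (indicator {\<omega> \<in> space M. cos (V \<omega>) < 0})"
    by simp
  \<comment> \<open>The two integrands differ only where the cosine is zero, a null set by
    \<open>nz\<close>.\<close>
  also have "\<dots> = expectation (\<lambda>\<omega>. 1 / 2 - sgn (cos (V \<omega>)) / 2)"
    using nz by (intro integral_cong_AE) (auto simp: indicator_def sgn_if elim!: eventually_mono)
  also have "\<dots> = 1 / 2 - expectation (\<lambda>\<omega>. sgn (cos (V \<omega>)) / 2)"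
    by (subst Bochner_Integration.integral_diff)
      (auto simp: prob_space intro!: integrable_const_bound[of _ 1] simp: sgn_if)
  finally show ?thesis using eq by simp
qed

subsection \<open>Dithered rounding errors\<close>

text \<open>As \<open>w\<close> runs through a unit interval, the rounding error runs once through
  \<open>[-1/2, 1/2)\<close>, in two pieces swapped by the jump of the quantizer. The integral is
  therefore independent of \<open>b\<close>.\<close>

lemma has_integral_dither:
  fixes f F :: "real \<Rightarrow> 'a :: euclidean_space"
  assumes F: "\<And>x. (F has_vector_derivative f x) (at x)"
  shows "((\<lambda>w. f (b + w - of_int (quantize (b + w)))) has_integral (F (1/2) - F (- 1/2))) {-1..0}"
proof -
  \<comment> \<open>The quantizer is constant in \<open>w\<close> on \<open>[-1, -t)\<close> and on
    \<open>[-t, 0)\<close>. The error is \<open>w + t + 1/2\<close> on the first piece and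
    \<open>w + t - 1/2\<close> on the second, so the values of \<open>F\<close> at
    \<open>t - 1/2\<close> cancel.\<close>
  define t where "t = frac (b + 1/2)"
  have t: "0 \<le> t" "t < 1" by (simp_all add: t_def frac_lt_1)
  have b: "b = of_int \<lfloor>b + 1/2\<rfloor> + t - 1/2" by (simp add: t_def frac_def)
  have shift: "((\<lambda>w. f (w + s)) has_integral (F (v + s) - F (u + s))) {u..v}" if "u \<le> v" for u v s
  proof (rule fundamental_theorem_of_calculus[OF that])
    fix w
    have "((\<lambda>w. w + s) has_vector_derivative 1) (at w)" by (auto intro!: derivative_eq_intros)
    from vector_diff_chain_at[OF this F] show "((\<lambda>w. F (w + s)) has_vector_derivative f (w + s)) (at w within {u..v})"
      by (simp add: o_def has_vector_derivative_at_within)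
  qed
  have low: "quantize (b + w) = \<lfloor>b + 1/2\<rfloor> - 1" if "-1 \<le> w" "w < - t" for w
    unfolding quantize_def using that t b by (intro floor_unique) auto
  have high: "quantize (b + w) = \<lfloor>b + 1/2\<rfloor>" if "- t \<le> w" "w < 0" for w
    unfolding quantize_def using that t b by (intro floor_unique) auto
  let ?g = "\<lambda>w. f (b + w - of_int (quantize (b + w)))"
  have "(?g has_integral (F (- t + (t + 1/2)) - F (- 1 + (t + 1/2)))) {-1..- t}"
  \<comment> \<open>The right end point already belongs to the next quantization interval and is
    removed as a single point.\<close>
  proof (rule has_integral_spike_finite[OF _ _ shift])
    fix w assume "w \<in> {-1..- t} - {- t}"
    then have "quantize (b + w) = \<lfloor>b + 1/2\<rfloor> - 1" by (intro low) auto
    then show "?g w = f (w + (t + 1/2))" using b by (intro arg_cong[where f = f]) simp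
  qed (use t in auto)
  moreover have "(?g has_integral (F (0 + (t - 1/2)) - F (- t + (t - 1/2)))) {- t..0}"
  proof (rule has_integral_spike_finite[OF _ _ shift])
    fix w assume "w \<in> {- t..0} - {0}"
    then have "quantize (b + w) = \<lfloor>b + 1/2\<rfloor>" by (intro high) auto
    then show "?g w = f (w + (t - 1/2))" using b by (intro arg_cong[where f = f]) simp
  qed (use t in auto)
  ultimately have "(?g has_integral (F (- t + (t + 1/2)) - F (- 1 + (t + 1/2)))
      + (F (0 + (t - 1/2)) - F (- t + (t - 1/2)))) {-1..0}"
    using t by (intro has_integral_combine) auto
  then show ?thesis by (simp add: algebra_simps)
qed

lemma measurable_quantize [measurable]: "quantize \<in> borel \<rightarrow>\<^sub>M count_space UNIV"
  unfolding quantize_def by measurable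

lemma integral_uniform_measure_Ico:
  fixes h :: "real \<Rightarrow> 'a :: euclidean_space"
  assumes [measurable]: "h \<in> borel_measurable borel" and bound: "\<And>w. norm (h w) \<le> B"
    and I: "(h has_integral I) {-1..0}"
  shows "(LINT w|uniform_measure lborel {-1..<0}. h w) = I"
proof -
  have "(LINT w|uniform_measure lborel {-1..<0}. h w) = (LINT w|density lborel (\<lambda>w. ennreal (indicator {-1..<0} w)). h w)"
    unfolding uniform_measure_def
    by (intro arg_cong2[where f = "integral\<^sup>L"] density_cong) (auto simp: indicator_def)
  also have "\<dots> = (LINT w:{-1..<0}|lborel. h w)"
    unfolding set_lebesgue_integral_def by (subst integral_density) auto
  also have "\<dots> = integral {-1..<0} h"
  proof (rule set_borel_integral_eq_integral(2))
    show "set_integrable lborel {-1..<0} h"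
      unfolding set_integrable_def
      by (rule integrableI_bounded_set_indicator[where B = B]) (auto simp: bound)
  qed
  also have "\<dots> = integral {-1..0} h"
    by (rule integral_subset_negligible) (auto intro: negligible_subset[of "{0}"])
  finally show ?thesis using I by (simp add: integral_unique)
qed

text \<open>This is the characteristic function of the uniform law on \<open>[-1/2, 1/2)\<close>,
  namely \<open>sin (c / 2) / (c / 2)\<close> for \<open>c \<noteq> 0\<close>; the argument
  \<open>c / (2 * pi)\<close> undoes the normalization of \<open>nsinc\<close>.\<close>

lemma dither_char:
  "(CLINT w|uniform_measure lborel {-1..<0}. iexp (c * (b + w - of_int (quantize (b + w)))))
    = of_real (nsinc (c / (2 * pi)))"
proof (rule integral_uniform_measure_Ico[where B = 1])
  define F :: "real \<Rightarrow> complex" where "F x = (if c = 0 then of_real x else iexp (c * x) / (\<i> * c))" for x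
  have "(F has_vector_derivative iexp (c * x)) (at x)" for x
  proof (cases "c = 0")
    case True
    then show ?thesis unfolding F_def
      by (auto intro!: derivative_eq_intros simp: has_vector_derivative_of_real)
  next
    case False
    then show ?thesis unfolding F_def
      by (auto intro!: derivative_eq_intros simp: Re_exp Im_exp Re_divide Im_divide
          has_vector_derivative_complex_iff field_simps power2_eq_square)
  qed
  then have "((\<lambda>w. iexp (c * (b + w - of_int (quantize (b + w))))) has_integral (F (1/2) - F (- 1/2))) {-1..0}"
    by (rule has_integral_dither)
  moreover have "F (1/2) - F (- 1/2) = of_real (nsinc (c / (2 * pi)))"
    unfolding F_def nsinc_def
    by (auto simp: complex_eq_iff Re_exp Im_exp Re_divide Im_divide field_simps power2_eq_square)
  ultimately show "((\<lambda>w. iexp (c * (b + w - of_int (quantize (b + w))))) has_integral of_real (nsinc (c / (2 * pi)))) {-1..0}"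
    by simp
  show "(\<lambda>w. iexp (c * (b + w - of_int (quantize (b + w))))) \<in> borel_measurable borel"
    by measurable
qed simp

text \<open>Fubini for the joint law, which is a product by independence. It allows averaging over
  the dither while the matrix is held fixed.\<close>

lemma (in prob_space) expectation_indep_var:
  fixes F :: "_ \<Rightarrow> 'b :: {banach, second_countable_topology}"
  assumes ind: "indep_var S X T Y" and F [measurable]: "F \<in> borel_measurable (S \<Otimes>\<^sub>M T)"
    and bound: "\<And>p. norm (F p) \<le> B"
  shows "expectation (\<lambda>\<omega>. F (X \<omega>, Y \<omega>)) = expectation (\<lambda>\<omega>. expectation (\<lambda>\<omega>'. F (X \<omega>, Y \<omega>')))"
proof -
  have [measurable]: "X \<in> M \<rightarrow>\<^sub>M S" "Y \<in> M \<rightarrow>\<^sub>M T"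
    and eq: "distr M S X \<Otimes>\<^sub>M distr M T Y = distr M (S \<Otimes>\<^sub>M T) (\<lambda>x. (X x, Y x))"
    using ind by (auto simp: indep_var_distribution_eq)
  interpret X: prob_space "distr M S X" by (rule prob_space_distr) simp
  interpret Y: prob_space "distr M T Y" by (rule prob_space_distr) simp
  interpret P: pair_prob_space "distr M S X" "distr M T Y" ..
  have "expectation (\<lambda>\<omega>. F (X \<omega>, Y \<omega>)) = integral\<^sup>L (distr M S X \<Otimes>\<^sub>M distr M T Y) F"
    unfolding eq by (subst integral_distr) auto
  also have "\<dots> = (LINT x|distr M S X. LINT y|distr M T Y. F (x, y))"
    by (subst P.integral_fst'[symmetric]) (auto intro!: P.P.integrable_const_bound[where B = B] simp: bound)
  also have "\<dots> = expectation (\<lambda>\<omega>. expectation (\<lambda>\<omega>'. F (X \<omega>, Y \<omega>')))"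
  proof (subst integral_distr)
    show "expectation (\<lambda>\<omega>. LINT y|distr M T Y. F (X \<omega>, y)) = expectation (\<lambda>\<omega>. expectation (\<lambda>\<omega>'. F (X \<omega>, Y \<omega>')))"
    proof (intro Bochner_Integration.integral_cong refl integral_distr)
      fix \<omega> assume "\<omega> \<in> space M"
      then show "(\<lambda>y. F (X \<omega>, y)) \<in> borel_measurable T"
        by (intro measurable_compose[OF measurable_Pair1' F] measurable_space[of X M S]) simp_all
    qed simp
  qed simp_all
  finally show ?thesis .
qed

text \<open>At a zero of the cosine, \<open>w\<close> is determined by two integers, the quantizer
  output and the index of the zero. Such \<open>w\<close> form a countable set.\<close>

lemma AE_uniform_cos_neq_0:
  assumes "c \<noteq> 0"
  shows "AE w in uniform_measure lborel {-1..<0}. cos (c * (z + (b + w - of_int (quantize (b + w))))) \<noteq> 0"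
proof (intro AE_uniform_measureI)
  let ?N = "range (\<lambda>(n, l). of_int l * (pi / 2) / c + of_int n - b - z :: real)"
  have "AE w in lborel. w \<notin> ?N"
    by (intro AE_not_in countable_imp_null_set_lborel) auto
  then show "AE w in lborel. w \<in> {-1..<0} \<longrightarrow> cos (c * (z + (b + w - of_int (quantize (b + w))))) \<noteq> 0"
  proof eventually_elim
    case (elim w)
    show ?case
    proof (intro impI notI)
      assume "cos (c * (z + (b + w - of_int (quantize (b + w))))) = 0"
      then obtain l :: int where "c * (z + (b + w - of_int (quantize (b + w)))) = of_int l * (pi / 2)"
        by (auto simp: cos_zero_iff_int)
      then have "w = (\<lambda>(n, l). of_int l * (pi / 2) / c + of_int n - b - z) (quantize (b + w), l)"
        using assms by (simp add: field_simps)
      then show False using elim by blast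
    qed
  qed
qed simp

section \<open>The dithered error: characteristic function and absence of ties\<close>

context prob_space
begin

context
  fixes B Z W :: "'a \<Rightarrow> real"
  \<comment> \<open>\<open>indep_var\<close> forces both variables to have the same type, hence the dummy component \<open>0\<close>.\<close>
  assumes ind: "indep_var (borel \<Otimes>\<^sub>M borel) (\<lambda>\<omega>. (B \<omega>, Z \<omega>)) (borel \<Otimes>\<^sub>M borel) (\<lambda>\<omega>. (0 :: real, W \<omega>))"
    and W: "distr M borel W = uniform_measure lborel {-1..<0}"
begin

lemma dithered_measurable: "B \<in> borel_measurable M" "Z \<in> borel_measurable M" "W \<in> borel_measurable M"
  using indep_var_rv1[OF ind] indep_var_rv2[OF ind]
  by (auto dest: measurable_compose[OF _ measurable_fst] measurable_compose[OF _ measurable_snd])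

text \<open>For fixed \<open>B\<close> and \<open>Z\<close> the average over the dither is the same
  sinc factor whatever \<open>B\<close> is. It comes out of the expectation, although
  \<open>B\<close> and \<open>Z\<close> may depend on each other.\<close>

lemma char_dithered:
  "(CLINT \<omega>|M. iexp (c * (Z \<omega> + (B \<omega> + W \<omega> - of_int (quantize (B \<omega> + W \<omega>))))))
    = of_real (nsinc (c / (2 * pi))) * char (distr M borel Z) c"
proof -
  note [measurable] = dithered_measurable
  let ?F = "\<lambda>p :: (real \<times> real) \<times> (real \<times> real). iexp (c * (snd (fst p)
      + (fst (fst p) + snd (snd p) - of_int (quantize (fst (fst p) + snd (snd p))))))"
  have "(CLINT \<omega>|M. iexp (c * (Z \<omega> + (B \<omega> + W \<omega> - of_int (quantize (B \<omega> + W \<omega>))))))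
    = expectation (\<lambda>\<omega>. ?F ((B \<omega>, Z \<omega>), (0, W \<omega>)))" by simp
  also have "\<dots> = expectation (\<lambda>\<omega>. expectation (\<lambda>\<omega>'. ?F ((B \<omega>, Z \<omega>), (0, W \<omega>'))))"
    by (rule expectation_indep_var[OF ind, where B = 1]) auto
  also have "\<dots> = expectation (\<lambda>\<omega>. of_real (nsinc (c / (2 * pi))) * iexp (c * Z \<omega>))"
  proof (intro Bochner_Integration.integral_cong refl)
    fix \<omega>
    have "(expectation (\<lambda>\<omega>'. ?F ((B \<omega>, Z \<omega>), (0, W \<omega>')))) =
      (LINT w|distr M borel W. iexp (c * Z \<omega>) * iexp (c * (B \<omega> + w - of_int (quantize (B \<omega> + w)))))"
      by (subst integral_distr) (simp_all add: exp_add[symmetric] algebra_simps)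
    also have "\<dots> = (LINT w|uniform_measure lborel {-1..<0}. iexp (c * Z \<omega>) * iexp (c * (B \<omega> + w - of_int (quantize (B \<omega> + w)))))"
      unfolding W ..
    finally show "(expectation (\<lambda>\<omega>'. ?F ((B \<omega>, Z \<omega>), (0, W \<omega>')))) = of_real (nsinc (c / (2 * pi))) * iexp (c * Z \<omega>)"
      by (simp only: integral_mult_right_zero dither_char mult.commute)
  qed
  also have "\<dots> = of_real (nsinc (c / (2 * pi))) * char (distr M borel Z) c"
    unfolding char_def by (subst integral_distr) auto
  finally show ?thesis .
qed

text \<open>The dither alone avoids the zeros for every fixed value of \<open>B\<close> and
  \<open>Z\<close>, so this also covers a degenerate \<open>Z\<close>, as when
  \<open>\<epsilon> = 0\<close>.\<close>

lemma AE_dithered_cos_neq_0: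
  assumes "c \<noteq> 0"
  shows "AE \<omega> in M. cos (c * (Z \<omega> + (B \<omega> + W \<omega> - of_int (quantize (B \<omega> + W \<omega>))))) \<noteq> 0"
proof -
  note [measurable] = dithered_measurable
  let ?F = "\<lambda>p :: (real \<times> real) \<times> (real \<times> real). of_bool (cos (c * (snd (fst p)
      + (fst (fst p) + snd (snd p) - of_int (quantize (fst (fst p) + snd (snd p)))))) = 0) :: real"
  have "expectation (\<lambda>\<omega>. ?F ((B \<omega>, Z \<omega>), (0, W \<omega>))) = expectation (\<lambda>\<omega>. expectation (\<lambda>\<omega>'. ?F ((B \<omega>, Z \<omega>), (0, W \<omega>'))))"
    by (rule expectation_indep_var[OF ind, where B = 1]) auto
  also have "\<dots> = expectation (\<lambda>\<omega>. 0)"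
  proof (intro Bochner_Integration.integral_cong refl)
    fix \<omega>
    show "(expectation (\<lambda>\<omega>'. ?F ((B \<omega>, Z \<omega>), (0, W \<omega>')))) = 0"
      using AE_uniform_cos_neq_0[OF assms, of "Z \<omega>" "B \<omega>"] unfolding W[symmetric]
      by (intro integral_eq_zero_AE) (auto simp: AE_distr_iff elim!: eventually_mono)
  qed
  finally have "expectation (\<lambda>\<omega>. ?F ((B \<omega>, Z \<omega>), (0, W \<omega>))) = 0" by simp
  then have "AE \<omega> in M. ?F ((B \<omega>, Z \<omega>), (0, W \<omega>)) = 0"
    by (subst (asm) integral_nonneg_eq_0_iff_AE) (auto intro!: integrable_const_bound[where B = 1])
  then show ?thesis by (auto elim!: eventually_mono)
qed

end

section \<open>Characteristic functions of Gaussian linear combinations\<close>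

lemma char_distr_normal_mult:
  assumes X: "distributed M lborel X (normal_density 0 \<sigma>)" and "\<sigma> > 0"
  shows "char (distr M borel (\<lambda>\<omega>. X \<omega> * a)) t = of_real (exp (- ((\<sigma> * a * t)\<^sup>2) / 2))"
proof -
  have [measurable]: "X \<in> borel_measurable M"
    using distributed_measurable[OF X] by simp
  have "distributed M lborel (\<lambda>\<omega>. (X \<omega> - 0) / \<sigma>) std_normal_density"
    using X normal_standard_normal_convert[OF \<open>\<sigma> > 0\<close>] by blast
  then have "distr M lborel (\<lambda>\<omega>. X \<omega> / \<sigma>) = std_normal_distribution"
    by (simp add: distributed_def)
  moreover have "distr M lborel (\<lambda>\<omega>. X \<omega> / \<sigma>) = distr M borel (\<lambda>\<omega>. X \<omega> / \<sigma>)"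
    by (intro distr_cong) auto
  ultimately have D: "distr M borel (\<lambda>\<omega>. X \<omega> / \<sigma>) = std_normal_distribution" by simp
  have "char (distr M borel (\<lambda>\<omega>. X \<omega> * a)) t = (CLINT \<omega>|M. iexp (t * (X \<omega> * a)))"
    unfolding char_def by (subst integral_distr) auto
  also have "\<dots> = (CLINT \<omega>|M. iexp ((\<sigma> * a * t) * (X \<omega> / \<sigma>)))"
    using \<open>\<sigma> > 0\<close> by (intro Bochner_Integration.integral_cong) (auto simp: field_simps)
  also have "\<dots> = char (distr M borel (\<lambda>\<omega>. X \<omega> / \<sigma>)) (\<sigma> * a * t)"
    unfolding char_def by (subst integral_distr) auto
  finally show ?thesis unfolding D char_std_normal_distribution .
qed

lemma char_distr_normal_sum:
  fixes X :: "'j \<Rightarrow> 'a \<Rightarrow> real"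
  assumes ind: "indep_vars (\<lambda>_. borel) X J"
    and X: "\<And>j. j \<in> J \<Longrightarrow> distributed M lborel (X j) (normal_density 0 \<sigma>)" and "\<sigma> > 0"
  shows "char (distr M borel (\<lambda>\<omega>. \<Sum>j\<in>J. X j \<omega> * a j)) t
    = of_real (exp (- ((\<sigma> * t)\<^sup>2 * (\<Sum>j\<in>J. (a j)\<^sup>2)) / 2))"
proof -
  have "char (distr M borel (\<lambda>\<omega>. \<Sum>j\<in>J. X j \<omega> * a j)) t = (\<Prod>j\<in>J. char (distr M borel (\<lambda>\<omega>. X j \<omega> * a j)) t)"
    by (intro char_distr_sum indep_vars_compose2[OF ind]) auto
  also have "\<dots> = (\<Prod>j\<in>J. of_real (exp (- ((\<sigma> * a j * t)\<^sup>2) / 2)))"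
    by (intro prod.cong refl char_distr_normal_mult X \<open>\<sigma> > 0\<close>)
  \<comment> \<open>For infinite \<open>J\<close> the product is 1 and the sum 0 by convention, so
    both sides are 1.\<close>
  also have "\<dots> = of_real (exp (- ((\<sigma> * t)\<^sup>2 * (\<Sum>j\<in>J. (a j)\<^sup>2)) / 2))"
    by (cases "finite J")
      (simp_all add: exp_sum[symmetric] sum_distrib_left sum_negf sum_divide_distrib power_mult_distrib mult_ac
        flip: of_real_prod)
  finally show ?thesis .
qed

end

subsection \<open>Nearest consistent integers\<close>

text \<open>Agreement in the lowest \<open>k - 1\<close> binary digits is congruence modulo
  \<open>2 ^ (k - 1)\<close>. Bit number \<open>i + 1\<close> of \<open>qbit\<close> is digit
  \<open>i\<close> of \<open>bit\<close>.\<close>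

lemma consistent_bits_iff:
  "consistent (map (\<lambda>l. qbit l Q) [1..<k]) j \<longleftrightarrow> (2::int) ^ (k - 1) dvd j - Q"
proof -
  have "consistent (map (\<lambda>l. qbit l Q) [1..<k]) j \<longleftrightarrow> (\<forall>i<k - 1. bit j i = bit Q i)"
    by (auto simp: consistent_def qbit_def bit_iff_odd odd_iff_mod_2_eq_one)
  also have "\<dots> \<longleftrightarrow> take_bit (k - 1) j = take_bit (k - 1) Q"
    by (auto simp: bit_eq_iff bit_take_bit_iff)
  also have "\<dots> \<longleftrightarrow> (2::int) ^ (k - 1) dvd j - Q"
    by (simp add: take_bit_eq_mod mod_eq_dvd_iff)
  finally show ?thesis .
qed

text \<open>The shift adds \<open>s\<close> to the quotient whose parity is the \<open>k\<close>-th
  bit.\<close>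

lemma qbit_add_mult: "qbit k (Q + 2 ^ (k - 1) * s) \<noteq> qbit k Q \<longleftrightarrow> odd s"
proof -
  have "qbit k (Q + 2 ^ (k - 1) * s) = (s + Q div 2 ^ (k - 1)) mod 2"
    by (simp add: qbit_def)
  moreover have "(s + m) mod 2 \<noteq> m mod 2 \<longleftrightarrow> odd s" for m
    by presburger
  ultimately show ?thesis by (simp add: qbit_def)
qed

lemma nearest_consistent_rule_bits:
  assumes "nearest_consistent_rule k rule"
  shows "is_arg_min (\<lambda>j. \<bar>t - real_of_int j\<bar>) (\<lambda>j. (2::int) ^ (k - 1) dvd j - Q) (rule t (map (\<lambda>l. qbit l Q) [1..<k]))"
proof -
  have "set (map (\<lambda>l. qbit l Q) [1..<k]) \<subseteq> {0, 1}"
    by (auto simp: qbit_def)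
  then have "nearest_consistent t (map (\<lambda>l. qbit l Q) [1..<k]) (rule t (map (\<lambda>l. qbit l Q) [1..<k]))"
    using assms unfolding nearest_consistent_rule_def by simp
  then show ?thesis
    unfolding nearest_consistent_def consistent_bits_iff .
qed

text \<open>Comparison with the two neighbours \<open>j + d\<close> and \<open>j - d\<close> already
  bounds the distance by half a step.\<close>

lemma is_arg_min_arith_progression:
  assumes "is_arg_min (\<lambda>j. \<bar>t - real_of_int j\<bar>) (\<lambda>j. d dvd j - Q) j" and "d > 0"
  obtains s where "j = Q + d * s" "\<bar>(t - Q) / d - s\<bar> \<le> 1 / 2"
proof -
  from assms have "d dvd j - Q" by (auto simp: is_arg_min_def)
  then obtain s where s: "j = Q + d * s" by (metis dvdE diff_add_cancel add.commute)
  have min: "\<bar>t - real_of_int j\<bar> \<le> \<bar>t - real_of_int (j + d * e)\<bar>" for e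
    using assms unfolding is_arg_min_def
    by (metis \<open>d dvd j - Q\<close> diff_add_eq dvd_add dvd_triv_left not_less)
  have "\<bar>t - real_of_int j\<bar> \<le> \<bar>t - real_of_int j - d\<bar>" "\<bar>t - real_of_int j\<bar> \<le> \<bar>t - real_of_int j + d\<bar>"
    using min[of 1] min[of "-1"] by (simp_all add: algebra_simps)
  then have "\<bar>t - real_of_int j\<bar> \<le> d / 2" using \<open>d > 0\<close> by linarith
  moreover have "(t - Q) / d - s = (t - real_of_int j) / d"
    using \<open>d > 0\<close> s by (simp add: field_simps)
  ultimately have "\<bar>(t - Q) / d - s\<bar> \<le> 1 / 2" using \<open>d > 0\<close> by (simp add: abs_divide field_simps)
  with s show ?thesis by (rule that)
qed

text \<open>Shifting the argument by \<open>pi * s\<close> multiplies the cosine by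
  \<open>(-1)^s\<close>, and the remaining angle lies in \<open>[-pi/2, pi/2]\<close>, where the
  cosine is nonnegative. A tie would make the cosine zero.\<close>

lemma odd_round_iff_cos_neg:
  fixes u :: real
  assumes "\<bar>u - of_int s\<bar> \<le> 1 / 2" "cos (pi * u) \<noteq> 0"
  shows "odd s \<longleftrightarrow> cos (pi * u) < 0"
proof -
  have "cos (pi * u) = cos (pi * (u - s) + pi * s)" by (simp add: algebra_simps)
  also have "\<dots> = cos (pi * (u - s)) * (if even s then 1 else - 1)"
    unfolding cos_add by simp
  finally have eq: "cos (pi * u) = cos (pi * (u - s)) * (if even s then 1 else - 1)" .
  have "\<bar>pi * (u - s)\<bar> \<le> pi / 2"
    using assms(1) mult_left_mono[OF assms(1), of pi] by (simp add: abs_mult)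
  then have "cos (pi * (u - s)) \<ge> 0" by (intro cos_ge_zero; linarith)
  then show ?thesis using eq assms(2) by (auto split: if_splits)
qed

lemma bit_error_iff_cos_neg:
  fixes t :: real
  assumes "nearest_consistent_rule k rule" and nz: "cos (pi / 2 ^ (k - 1) * (t - Q)) \<noteq> 0"
  shows "qbit k (rule t (map (\<lambda>l. qbit l Q) [1..<k])) \<noteq> qbit k Q
    \<longleftrightarrow> cos (pi / 2 ^ (k - 1) * (t - Q)) < 0"
proof -
  obtain s where s: "rule t (map (\<lambda>l. qbit l Q) [1..<k]) = Q + 2 ^ (k - 1) * s"
    "\<bar>(t - Q) / real_of_int (2 ^ (k - 1)) - s\<bar> \<le> 1 / 2"
    using is_arg_min_arith_progression[OF nearest_consistent_rule_bits[OF assms(1)]] by auto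
  show ?thesis
    using odd_round_iff_cos_neg[OF s(2)] nz unfolding s(1) qbit_add_mult by simp
qed

text \<open>Ties are broken arbitrarily, but only at the end points of an interval, so the rule is
  nevertheless measurable.\<close>

lemma rule_vimage_borel:
  assumes "nearest_consistent_rule k rule"
  shows "{t. rule t (map (\<lambda>l. qbit l Q) [1..<k]) = j} \<in> sets borel"
proof (rule real_interval_borel_measurable, unfold is_interval_1, safe)
  let ?bs = "map (\<lambda>l. qbit l Q) [1..<k]"
  let ?C = "\<lambda>j. (2::int) ^ (k - 1) dvd j - Q"
  fix a b t assume ab: "a \<le> t" "t \<le> b" and a: "j = rule a ?bs" and b: "rule b ?bs = rule a ?bs"
  define j' where "j' = rule t ?bs"
  have min: "?C (rule v ?bs) \<and> (?C i \<longrightarrow> \<bar>v - rule v ?bs\<bar> \<le> \<bar>v - i\<bar>)" for v i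
    using nearest_consistent_rule_bits[OF assms, of v Q] unfolding is_arg_min_def by force
  have "\<bar>a - j\<bar> \<le> \<bar>a - j'\<bar>" "\<bar>b - j\<bar> \<le> \<bar>b - j'\<bar>" "\<bar>t - j'\<bar> \<le> \<bar>t - j\<bar>"
    using min[of a j'] min[of b j'] min[of t j] min[of t 0] min[of a 0] a b by (auto simp: j'_def)
  \<comment> \<open>If \<open>j' \<noteq> j\<close>, then \<open>a\<close> and \<open>b\<close> lie
    on the side of \<open>j\<close> of the midpoint between \<open>j\<close> and \<open>j'\<close>,
    and \<open>t\<close> on the other side; both sides contain the midpoint, so \<open>t\<close> is
    an end point.\<close>
  then have "t = a \<or> t = b \<or> j' = j"
    using ab by (auto simp: abs_if split: if_splits)
  then show "rule t ?bs = rule a ?bs" using a b by (auto simp: j'_def)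
qed

lemma bit_error_borel:
  assumes "nearest_consistent_rule k rule"
  shows "{t. qbit k (rule t (map (\<lambda>l. qbit l Q) [1..<k])) \<noteq> qbit k Q} \<in> sets borel"
proof -
  have "{t. qbit k (rule t (map (\<lambda>l. qbit l Q) [1..<k])) \<noteq> qbit k Q}
    = (\<Union>j\<in>{j. qbit k j \<noteq> qbit k Q}. {t. rule t (map (\<lambda>l. qbit l Q) [1..<k]) = j})" by auto
  also have "\<dots> \<in> sets borel"
    by (intro sets.countable_UN') (use rule_vimage_borel[OF assms] in auto)
  finally show ?thesis .
qed

subsection \<open>The bit error probability\<close>

theorem theorem1:
  fixes M :: "'w measure"
    and \<Delta> \<sigma> \<epsilon> :: real
    and x xhat :: "real ^ 'n"
    and A :: "'w \<Rightarrow> real ^ 'n ^ 'm"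
    and w y yhat :: "'w \<Rightarrow> real ^ 'm"
    and q :: "'w \<Rightarrow> int ^ 'm"
    and k :: nat
    and rule :: "real \<Rightarrow> int list \<Rightarrow> int"
    and i :: 'm
  assumes "prob_space M"
    and "\<Delta> > 0" and "\<sigma> > 0" and "k \<ge> 1"
    and "\<epsilon> = norm (x - xhat)"
    and A_normal: "\<And>i j. distributed M lborel (\<lambda>\<omega>. A \<omega> $ i $ j) (normal_density 0 \<sigma>)"
    and w_uniform: "\<And>i. distr M borel (\<lambda>\<omega>. w \<omega> $ i) = uniform_measure lborel {-1..<0}"
    and indep: "prob_space.indep_vars M (\<lambda>_. borel)
          (\<lambda>e \<omega>. case e of Inl (i, j) \<Rightarrow> A \<omega> $ i $ j | Inr i \<Rightarrow> w \<omega> $ i)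
          (UNIV :: ('m \<times> 'n + 'm) set)"
    and "\<And>\<omega>. y \<omega> = (1 / \<Delta>) *\<^sub>R (A \<omega> *v x) + w \<omega>"
    and "\<And>\<omega>. yhat \<omega> = (1 / \<Delta>) *\<^sub>R (A \<omega> *v xhat) + w \<omega>"
    and "\<And>\<omega>. q \<omega> = (\<chi> i. quantize (y \<omega> $ i))"
    and "nearest_consistent_rule k rule"
  defines "bit_error \<equiv> {\<omega> \<in> space M.
      predicted_bitplane rule k (yhat \<omega>) (map (\<lambda>l. bitplane l (q \<omega>)) [1..<k]) $ i
        \<noteq> bitplane k (q \<omega>) $ i}"
    and "summand \<equiv> (\<lambda>l :: nat. exp (- (1 / 2) * (pi * \<sigma> * \<epsilon> * real l / (2 ^ (k - 1) * \<Delta>))\<^sup>2)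
      * nsinc (real l / 2 ^ k) * nsinc (real l / 2))"
  shows "bit_error \<in> sets M
    \<and> summable (\<lambda>l. summand (Suc l))
    \<and> measure M bit_error = 1 / 2 - (\<Sum>l. summand (Suc l))"
proof -
  interpret prob_space M by fact
  let ?X = "\<lambda>e \<omega>. case e of Inl (i, j) \<Rightarrow> A \<omega> $ i $ j | Inr i \<Rightarrow> w \<omega> $ i"
  let ?row = "range (\<lambda>j. Inl (i, j)) :: ('m \<times> 'n + 'm) set"
  \<comment> \<open>These are the coefficients of \<open>yhat - y\<close>: \<open>Z\<close> is the
    prediction error at coordinate \<open>i\<close>, and \<open>B\<close> the measurement before
    dithering.\<close>
  define a where "a j = (xhat $ j - x $ j) / \<Delta>" for j
  define B where "B \<omega> = (\<Sum>j\<in>UNIV. A \<omega> $ i $ j * (x $ j / \<Delta>))" for \<omega>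
  define Z where "Z \<omega> = (\<Sum>j\<in>UNIV. A \<omega> $ i $ j * a j)" for \<omega>
  define W where "W \<omega> = w \<omega> $ i" for \<omega>
  define c where "c = pi / 2 ^ (k - 1)"
  define V where "V \<omega> = c * (Z \<omega> + (B \<omega> + W \<omega> - of_int (quantize (B \<omega> + W \<omega>))))" for \<omega>
  have "c > 0" by (simp add: c_def)
  have y: "y \<omega> $ i = B \<omega> + W \<omega>" and yhat: "yhat \<omega> $ i = Z \<omega> + (B \<omega> + W \<omega>)" for \<omega>
    unfolding assms(9,10) B_def Z_def W_def a_def
    by (simp_all add: matrix_vector_mult_def sum_distrib_left sum.distrib[symmetric] field_simps
        diff_divide_distrib)
  have q: "q \<omega> $ i = quantize (B \<omega> + W \<omega>)" for \<omega>
    unfolding assms(11) by (simp add: y)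
  have W: "distr M borel W = uniform_measure lborel {-1..<0}"
    unfolding W_def by (rule w_uniform)
  have row: "indep_vars (\<lambda>_. borel) (\<lambda>j \<omega>. A \<omega> $ i $ j) UNIV"
  proof -
    have "indep_vars (\<lambda>j. PiM {Inl (i, j)} (\<lambda>_. borel)) (\<lambda>j \<omega>. restrict (\<lambda>e. ?X e \<omega>) {Inl (i, j)}) UNIV"
      by (rule indep_vars_restrict[OF indep]) (auto simp: disjoint_family_on_def)
    from indep_vars_compose2[OF this, of "\<lambda>j v. v (Inl (i, j))" "\<lambda>_. borel"] show ?thesis by simp
  qed
  have ind: "indep_var (borel \<Otimes>\<^sub>M borel) (\<lambda>\<omega>. (B \<omega>, Z \<omega>)) (borel \<Otimes>\<^sub>M borel) (\<lambda>\<omega>. (0 :: real, W \<omega>))"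
  proof -
    let ?f = "\<lambda>v. (\<Sum>j\<in>UNIV. v (Inl (i, j)) * (x $ j / \<Delta>), \<Sum>j\<in>UNIV. v (Inl (i, j)) * a j)"
    let ?g = "\<lambda>v. (0 :: real, v (Inr i :: 'm \<times> 'n + 'm) :: real)"
    \<comment> \<open>Row \<open>i\<close> of the matrix and the dither entry \<open>i\<close> use
      disjoint sets of indices of the independent family.\<close>
    have "indep_var (borel \<Otimes>\<^sub>M borel) (?f \<circ> (\<lambda>\<omega>. restrict (\<lambda>e. ?X e \<omega>) ?row))
        (borel \<Otimes>\<^sub>M borel) (?g \<circ> (\<lambda>\<omega>. restrict (\<lambda>e. ?X e \<omega>) {Inr i}))"
      by (rule indep_var_compose[OF indep_var_restrict[OF indep]]) auto
    then show ?thesis by (simp add: o_def B_def Z_def W_def)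
  qed
  note [measurable] = dithered_measurable[OF ind W]
  have V [measurable]: "V \<in> borel_measurable M" unfolding V_def by measurable
  have nz: "AE \<omega> in M. cos (V \<omega>) \<noteq> 0"
    unfolding V_def using \<open>c > 0\<close> by (intro AE_dithered_cos_neq_0[OF ind W]) simp
  have expect: "nsinc (real l / 2) * expectation (\<lambda>\<omega>. cos (real l * V \<omega>)) = summand l" for l
  proof -
    have "expectation (\<lambda>\<omega>. cos (real l * V \<omega>)) = expectation (\<lambda>\<omega>. Re (iexp (real l * V \<omega>)))"
      by (simp add: Re_exp)
    also have "\<dots> = Re (CLINT \<omega>|M. iexp (real l * V \<omega>))"
      by (intro integral_Re integrable_const_bound[where B = 1]) auto
    also have "(CLINT \<omega>|M. iexp (real l * V \<omega>))
        = of_real (nsinc (real l * c / (2 * pi))) * char (distr M borel Z) (real l * c)"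
      using char_dithered[OF ind W, of "real l * c"] by (simp add: V_def mult.assoc)
    also have "char (distr M borel Z) (real l * c)
        = of_real (exp (- ((\<sigma> * (real l * c))\<^sup>2 * (\<Sum>j\<in>UNIV. (a j)\<^sup>2)) / 2))"
      unfolding Z_def by (intro char_distr_normal_sum row A_normal \<open>\<sigma> > 0\<close>)
    also have "(\<Sum>j\<in>UNIV. (a j)\<^sup>2) = (\<epsilon> / \<Delta>)\<^sup>2"
      unfolding assms(5) a_def
      by (simp add: norm_vec_def L2_set_def power_divide sum_nonneg sum_divide_distrib[symmetric]
          power2_commute)
    also have "(\<sigma> * (real l * c))\<^sup>2 * (\<epsilon> / \<Delta>)\<^sup>2 = (pi * \<sigma> * \<epsilon> * real l / (2 ^ (k - 1) * \<Delta>))\<^sup>2"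
      unfolding c_def by (simp add: power_mult_distrib power_divide)
    \<comment> \<open>Here \<open>k \<ge> 1\<close> matters: \<open>2 * 2 ^ (k - 1) = 2 ^ k\<close>
      fails at 0, where subtraction truncates.\<close>
    also have "real l * c / (2 * pi) = real l / 2 ^ k"
      using \<open>k \<ge> 1\<close> unfolding c_def by (cases k) simp_all
    finally show ?thesis by (simp add: summand_def)
  qed
  \<comment> \<open>Each sinc contributes a factor of order \<open>1 / l\<close>. The exponential is
    bounded only by 1, since it does not decay when \<open>\<epsilon> = 0\<close>.\<close>
  have abs_summable: "summable (\<lambda>l. \<bar>summand (Suc l)\<bar>)"
  proof (rule summable_comparison_test'[where N = 0])
    let ?C = "2 ^ (k + 1) / pi\<^sup>2"
    show "summable (\<lambda>l. ?C * inverse (real (Suc l) ^ 2))"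
      by (intro summable_mult) (subst summable_Suc_iff, simp add: inverse_power_summable)
    fix l
    have 1: "\<bar>nsinc (real (Suc l) / 2 ^ k)\<bar> \<le> 1 / (pi * (real (Suc l) / 2 ^ k))"
      and 2: "\<bar>nsinc (real (Suc l) / 2)\<bar> \<le> 1 / (pi * (real (Suc l) / 2))"
      by (intro abs_nsinc_le; simp)+
    have "\<bar>summand (Suc l)\<bar> \<le> 1 * (1 / (pi * (real (Suc l) / 2 ^ k))) * (1 / (pi * (real (Suc l) / 2)))"
      unfolding summand_def abs_mult by (intro mult_mono 1 2) auto
    also have "\<dots> = ?C * inverse (real (Suc l) ^ 2)"
      by (simp add: power2_eq_square field_simps)
    finally show "norm \<bar>summand (Suc l)\<bar> \<le> ?C * inverse (real (Suc l) ^ 2)" by simp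
  qed
  let ?bits = "\<lambda>Q. map (\<lambda>l. qbit l Q) [1..<k]"
  let ?E = "\<lambda>Q. {t. qbit k (rule t (?bits Q)) \<noteq> qbit k Q}"
  have error_iff: "predicted_bitplane rule k (yhat \<omega>) (map (\<lambda>l. bitplane l (q \<omega>)) [1..<k]) $ i
      \<noteq> bitplane k (q \<omega>) $ i \<longleftrightarrow> Z \<omega> + (B \<omega> + W \<omega>) \<in> ?E (quantize (B \<omega> + W \<omega>))" for \<omega>
    by (simp add: predicted_bitplane_def bitplane_def o_def q yhat)
  \<comment> \<open>The known bits depend on the quantizer output; fixing its value \<open>Q\<close>
    reduces measurability to countably many events with a fixed bit list.\<close>
  have "bit_error = (\<Union>Q. {\<omega> \<in> space M. quantize (B \<omega> + W \<omega>) = Q \<and> Z \<omega> + (B \<omega> + W \<omega>) \<in> ?E Q})"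
    unfolding bit_error_def error_iff by auto
  also have "\<dots> \<in> sets M"
  proof (rule sets.countable_UN''[OF countableI_type])
    fix Q :: int
    have [measurable]: "?E Q \<in> sets borel" by (rule bit_error_borel) fact
    show "{\<omega> \<in> space M. quantize (B \<omega> + W \<omega>) = Q \<and> Z \<omega> + (B \<omega> + W \<omega>) \<in> ?E Q} \<in> sets M"
      by measurable
  qed
  finally have sets: "bit_error \<in> sets M" .
  \<comment> \<open>The two events agree wherever \<open>cos (V \<omega>)\<close> is nonzero, hence
    almost everywhere.\<close>
  have "measure M bit_error = measure M {\<omega> \<in> space M. cos (V \<omega>) < 0}"
  proof (rule finite_measure_eq_AE[OF _ sets])
    show "AE \<omega> in M. \<omega> \<in> bit_error \<longleftrightarrow> \<omega> \<in> {\<omega> \<in> space M. cos (V \<omega>) < 0}"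
      using nz AE_space
    proof eventually_elim
      case (elim \<omega>)
      have V_eq: "V \<omega> = pi / 2 ^ (k - 1) * (Z \<omega> + (B \<omega> + W \<omega>) - of_int (quantize (B \<omega> + W \<omega>)))"
        by (simp add: V_def c_def algebra_simps)
      show ?case
        using elim bit_error_iff_cos_neg[OF assms(12)] unfolding bit_error_def error_iff
        by (simp add: V_eq)
    qed
  qed simp
  also have "\<dots> = 1 / 2 - (\<Sum>l. summand (Suc l))"
    using prob_cos_neg[OF V nz] abs_summable unfolding expect by simp
  finally show ?thesis using sets summable_rabs_cancel[OF abs_summable] by simp
qed

end
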